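(* For every integer $n\ge 1$, $$R_n(t)=\sum_{\sigma\in\mathcal{RS}\mathrm{I}_n} t^{\,n-2\,\mathrm{npk}(\sigma)}.$$
   Context: The polynomial $R_n$ is defined by $\frac{d^n}{dx^n}\sec^2 x=R_n(\tan x)\sec^2 x$. $\mathfrak{S}_n$ is the symmetric group on $[n]=\{1,\dots,n\}$, with permutations written as words. A double descent of a word of distinct integers is a triple of consecutive letters $a>b>c$. A permutation $\sigma\in\mathfrak{S}_n$ is a Simsun permutation if for all $1\le k\le n$, the subword of $\sigma$ consisting of the letters $1,\dots,k$ (in the order they appear in $\sigma$) has no double descent. A signed permutation of $[n]$ is a bijection $\sigma$ of $\{\pm1,\dots,\pm n\}$ onto itself with $\sigma(-i)=-\sigma(i)$, written $\sigma=(\sigma_1,\dots,\sigma_n)$ with $\sigma_i=\sigma(i)$; $B_n$ is the set of these. Put $|\sigma|=(|\sigma_1|,\dots,|\sigma_n|)\in\mathfrak{S}_n$. $\mathcal{RS}\mathrm{I}_n$ (signed Simsun permutations of type I) is the set of $\sigma\in B_n$ such that $|\sigma|$ is a Simsun permutation. For $\sigma\in\mathcal{RS}\mathrm{I}_n$, $\mathrm{npk}(\sigma)=\#\{i: 1\le i\le n-1,\ \sigma_i<0,\ |\sigma_i|>|\sigma_{i+1}|\}$. *)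

theory Defs
  imports "HOL-Analysis.Analysis" "HOL-Computational_Algebra.Polynomial"
    "HOL-Combinatorics.Combinatorics"
begin

definition sec :: "real \<Rightarrow> real" where
  "sec x = 1 / cos x"

text \<open>The defining identity is required on the natural domain of the secant; existence and
  uniqueness of the polynomial are proved in \<open>R_poly_ex1\<close> below.\<close>

definition R_poly :: "nat \<Rightarrow> real poly" where
  "R_poly n = (THE p. \<forall>x. cos x \<noteq> 0 \<longrightarrow>
      (deriv ^^ n) (\<lambda>x. (sec x)\<^sup>2) x = poly p (tan x) * (sec x)\<^sup>2)"

text \<open>\<open>permutations_of_set {1..int n}\<close> is the symmetric group on \<open>[n]\<close>, written as words.
  Letters are integers so that the absolute values of signed permutations need no coercion.\<close>

definition has_double_descent :: "int list \<Rightarrow> bool" where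
  "has_double_descent w \<longleftrightarrow>
     (\<exists>i. i + 2 < length w \<and> w ! i > w ! (i + 1) \<and> w ! (i + 1) > w ! (i + 2))"

definition simsun :: "nat \<Rightarrow> int list set" where
  "simsun n = {w \<in> permutations_of_set {1..int n}.
     \<forall>k\<in>{1..int n}. \<not> has_double_descent (filter (\<lambda>a. a \<le> k) w)}"

definition signed_dom :: "nat \<Rightarrow> int set" where
  "signed_dom n = {- int n..int n} - {0}"

text \<open>Being a total function on \<open>int\<close>, a signed permutation is normalised to be the identity
  outside its domain (part of \<open>permutes\<close>), so that distinct signed permutations correspond to
  distinct functions.\<close>

definition signed_perms :: "nat \<Rightarrow> (int \<Rightarrow> int) set" where
  "signed_perms n = {\<sigma>. \<sigma> permutes signed_dom n \<and> (\<forall>i\<in>signed_dom n. \<sigma> (- i) = - \<sigma> i)}"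

definition abs_word :: "nat \<Rightarrow> (int \<Rightarrow> int) \<Rightarrow> int list" where
  "abs_word n \<sigma> = map (\<lambda>i. \<bar>\<sigma> i\<bar>) [1..int n]"

definition RSI :: "nat \<Rightarrow> (int \<Rightarrow> int) set" where
  "RSI n = {\<sigma> \<in> signed_perms n. abs_word n \<sigma> \<in> simsun n}"

definition npk :: "nat \<Rightarrow> (int \<Rightarrow> int) \<Rightarrow> nat" where
  "npk n \<sigma> = card {i. 1 \<le> i \<and> i \<le> int n - 1 \<and> \<sigma> i < 0 \<and> \<bar>\<sigma> i\<bar> > \<bar>\<sigma> (i + 1)\<bar>}"

lemma finite_RSI: "finite (RSI n)"
proof (rule finite_subset)
  show "RSI n \<subseteq> {\<sigma>. \<sigma> permutes signed_dom n}"
    by (auto simp: RSI_def signed_perms_def)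
  show "finite {\<sigma>. \<sigma> permutes signed_dom n}"
    by (rule finite_permutations) (simp add: signed_dom_def)
qed

text \<open>The subtraction \<open>n - 2 * npk n \<sigma>\<close> on natural numbers does not truncate.\<close>

lemma two_npk_le:
  assumes "\<sigma> \<in> RSI n"
  shows "2 * npk n \<sigma> \<le> n"
proof (cases "n = 0")
  case True
  then have "{i. 1 \<le> i \<and> i \<le> int n - 1 \<and> \<sigma> i < 0 \<and> \<bar>\<sigma> i\<bar> > \<bar>\<sigma> (i + 1)\<bar>} = {}" by auto
  then have "npk n \<sigma> = 0" unfolding npk_def by (simp only: card.empty)
  then show ?thesis by simp
next
  case False
  define D where "D = {i. 1 \<le> i \<and> i \<le> int n - 1 \<and> \<sigma> i < 0 \<and> \<bar>\<sigma> i\<bar> > \<bar>\<sigma> (i + 1)\<bar>}"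
  let ?w = "abs_word n \<sigma>"
  have len: "length ?w = n" by (simp add: abs_word_def)
  have nth: "?w ! j = \<bar>\<sigma> (1 + int j)\<bar>" if "j < n" for j
    using that by (simp add: abs_word_def)
  have w: "?w \<in> simsun n" using assms by (simp add: RSI_def)
  then have "set ?w = {1..int n}"
    by (auto simp: simsun_def permutations_of_set_def)
  then have "filter (\<lambda>a. a \<le> int n) ?w = ?w" by (auto simp: filter_id_conv)
  moreover have "int n \<in> {1..int n}" using False by simp
  ultimately have ndd: "\<not> has_double_descent ?w"
    using w unfolding simsun_def mem_Collect_eq by metis
  have fin: "finite D" by (rule finite_subset[of _ "{1..int n}"]) (auto simp: D_def)
  have disj: "D \<inter> (\<lambda>i. i + 1) ` D = {}"
  proof (rule ccontr)
    assume "D \<inter> (\<lambda>i. i + 1) ` D \<noteq> {}"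
    then obtain i where i: "i \<in> D" "i + 1 \<in> D" by auto
    define j where "j = nat (i - 1)"
    have j: "i = 1 + int j" "j + 2 < n" using i by (auto simp: D_def j_def)
    have "has_double_descent ?w"
      unfolding has_double_descent_def
      using i j by (intro exI[of _ j]) (auto simp: len nth D_def algebra_simps)
    with ndd show False by simp
  qed
  have "2 * card D = card (D \<union> (\<lambda>i. i + 1) ` D)"
    using fin disj by (subst card_Un_disjoint) (auto simp: card_image)
  also have "\<dots> \<le> card {1..int n}"
    by (rule card_mono) (auto simp: D_def)
  finally show ?thesis by (simp add: npk_def D_def)
qed

lemma R_poly_ex1:
  "\<exists>!p. \<forall>x. cos x \<noteq> 0 \<longrightarrow>
      (deriv ^^ n) (\<lambda>x. (sec x)\<^sup>2) x = poly p (tan x) * (sec x)\<^sup>2"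
proof -
  have ex: "\<exists>p. \<forall>x. cos x \<noteq> 0 \<longrightarrow>
      (deriv ^^ n) (\<lambda>x. (sec x)\<^sup>2) x = poly p (tan x) * (sec x)\<^sup>2"
  proof (induction n)
    case 0
    show ?case by (rule exI[of _ 1]) simp
  next
    case (Suc n)
    then obtain p where p: "\<And>x. cos x \<noteq> 0 \<Longrightarrow>
      (deriv ^^ n) (\<lambda>x. (sec x)\<^sup>2) x = poly p (tan x) * (sec x)\<^sup>2" by blast
    show ?case
    proof (intro exI[of _ "pderiv p * [:1, 0, 1:] + [:0, 2:] * p"] allI impI)
      fix x :: real assume x: "cos x \<noteq> 0"
      have "open {y :: real. cos y \<noteq> 0}"
        by (intro open_Collect_neq continuous_intros)
      then have "\<forall>\<^sub>F y in nhds x. (deriv ^^ n) (\<lambda>x. (sec x)\<^sup>2) y = poly p (tan y) * (sec y)\<^sup>2"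
        using x p by (auto simp: eventually_nhds)
      then have "deriv ((deriv ^^ n) (\<lambda>x. (sec x)\<^sup>2)) x
          = deriv (\<lambda>y. poly p (tan y) * (sec y)\<^sup>2) x"
        by (intro deriv_cong_ev) auto
      also have "\<dots> = poly (pderiv p) (tan x) * (sec x)\<^sup>2 * (sec x)\<^sup>2
          + 2 * tan x * poly p (tan x) * (sec x)\<^sup>2"
        unfolding sec_def using x
        by (intro DERIV_imp_deriv)
           (auto intro!: derivative_eq_intros poly_DERIV[THEN DERIV_chain2]
             simp: field_simps tan_def power2_eq_square)
      also have "\<dots> = poly (pderiv p * [:1, 0, 1:] + [:0, 2:] * p) (tan x) * (sec x)\<^sup>2"
      proof -
        have s: "(sec x)\<^sup>2 = 1 + (tan x)\<^sup>2"
          using tan_sec[OF x] by (simp add: sec_def power_divide inverse_eq_divide)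
        show ?thesis unfolding s by (simp add: algebra_simps power2_eq_square)
      qed
      finally show "(deriv ^^ Suc n) (\<lambda>x. (sec x)\<^sup>2) x
          = poly (pderiv p * [:1, 0, 1:] + [:0, 2:] * p) (tan x) * (sec x)\<^sup>2"
        by simp
    qed
  qed
  show ?thesis
  proof (rule ex_ex1I[OF ex])
    fix p q :: "real poly"
    assume p: "\<forall>x. cos x \<noteq> 0 \<longrightarrow> (deriv ^^ n) (\<lambda>x. (sec x)\<^sup>2) x = poly p (tan x) * (sec x)\<^sup>2"
      and q: "\<forall>x. cos x \<noteq> 0 \<longrightarrow> (deriv ^^ n) (\<lambda>x. (sec x)\<^sup>2) x = poly q (tan x) * (sec x)\<^sup>2"
    have "poly p t = poly q t" for t
    proof -
      have c: "cos (arctan t) \<noteq> 0" by simp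
      then have "poly p t * (sec (arctan t))\<^sup>2 = poly q t * (sec (arctan t))\<^sup>2"
        using p q by (metis tan_arctan)
      with c show ?thesis by (simp add: sec_def)
    qed
    then show "p = q" by (simp add: poly_eq_poly_eq_iff[symmetric] fun_eq_iff)
  qed
qed

end

theory Submission
  imports Defs
begin

text \<open>
  Since \<open>tan' = sec\<^sup>2 = 1 + tan\<^sup>2\<close>, differentiating the defining identity once more gives
  \<open>R\<^bsub>n+1\<^esub> = (1 + t\<^sup>2) R\<^sub>n' + 2 t R\<^sub>n\<close> with \<open>R\<^sub>0 = 1\<close>
  (\<open>R_poly_Suc\<close>, \<open>R_poly_0\<close>). The combinatorial side satisfies the same recurrence once the
  signs are summed out.

  Fix a Simsun word \<open>w\<close> of length \<open>n\<close> with \<open>d\<close> descents. Among the signed permutations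
  \<open>\<sigma>\<close> with \<open>|\<sigma>| = w\<close>, the statistic \<open>npk\<close> counts the descents of \<open>w\<close> whose top
  carries a minus sign. Apart from the common factor \<open>t\<^sup>n\<close>, each of the \<open>n - d\<close> other positions contributes a factor
  \<open>2\<close>; each descent contributes \<open>1 + t\<^sup>-\<^sup>2\<close>. Hence these \<open>\<sigma>\<close> contribute
  \<open>2\<^bsup>n-d\<^esup> t\<^bsup>n-2d\<^esup> (1 + t\<^sup>2)\<^sup>d\<close> (\<open>sum_signs\<close>), which is
  \<open>term_poly n d\<close> below.

  Every Simsun word of length \<open>n + 1\<close> arises exactly once by inserting \<open>n + 1\<close> into a
  Simsun word \<open>w\<close> of length \<open>n\<close>. As the new letter is maximal, it creates a double
  descent exactly when it is put directly before a descent top; of the \<open>n + 1 - d\<close> remaining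
  gaps, the \<open>d\<close> gaps inside a descent and the final gap keep the number of descents, and the
  other \<open>n - 2d\<close> raise it by one (\<open>sum_over_insertions\<close>). The operator
  \<open>f \<mapsto> (1 + t\<^sup>2) f' + 2 t f\<close> acts in the same way: it sends \<open>term_poly n d\<close> to
  \<open>(d + 1) term_poly (n + 1) d + (n - 2d) term_poly (n + 1) (d + 1)\<close>
  (\<open>term_poly_recurrence\<close>). So \<open>R\<^sub>n\<close> is the sum of \<open>term_poly n (card (descents w))\<close> over the
  Simsun words, by induction from the empty word.
\<close>

section \<open>The recurrence for the derivative polynomials\<close>

lemma R_poly_deriv:
  assumes "cos x \<noteq> 0"
  shows "(deriv ^^ n) (\<lambda>x. (sec x)\<^sup>2) x = poly (R_poly n) (tan x) * (sec x)\<^sup>2"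
  using theI'[OF R_poly_ex1[of n]] assms unfolding R_poly_def by blast

lemma R_poly_eqI:
  assumes "\<And>x. cos x \<noteq> 0 \<Longrightarrow> (deriv ^^ n) (\<lambda>x. (sec x)\<^sup>2) x = poly p (tan x) * (sec x)\<^sup>2"
  shows "R_poly n = p"
  unfolding R_poly_def by (rule the1_equality[OF R_poly_ex1]) (use assms in blast)

lemma R_poly_0: "R_poly 0 = 1"
  by (rule R_poly_eqI) simp

lemma R_poly_Suc: "R_poly (Suc n) = pderiv (R_poly n) * [:1, 0, 1:] + [:0, 2:] * R_poly n"
proof (rule R_poly_eqI)
  fix x :: real assume x: "cos x \<noteq> 0"
  let ?p = "R_poly n"
  have "open {y :: real. cos y \<noteq> 0}"
    by (intro open_Collect_neq continuous_intros)
  then have "\<forall>\<^sub>F y in nhds x. (deriv ^^ n) (\<lambda>x. (sec x)\<^sup>2) y = poly ?p (tan y) * (sec y)\<^sup>2"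
    using x R_poly_deriv[of _ n] by (auto simp: eventually_nhds)
  then have "deriv ((deriv ^^ n) (\<lambda>x. (sec x)\<^sup>2)) x = deriv (\<lambda>y. poly ?p (tan y) * (sec y)\<^sup>2) x"
    by (intro deriv_cong_ev) auto
  also have "\<dots> = poly (pderiv ?p) (tan x) * (sec x)\<^sup>2 * (sec x)\<^sup>2
      + 2 * tan x * poly ?p (tan x) * (sec x)\<^sup>2"
    unfolding sec_def using x
    by (intro DERIV_imp_deriv)
      (auto intro!: derivative_eq_intros poly_DERIV[THEN DERIV_chain2]
        simp: field_simps tan_def power2_eq_square)
  also have "\<dots> = poly (pderiv ?p * [:1, 0, 1:] + [:0, 2:] * ?p) (tan x) * (sec x)\<^sup>2"
  proof -
    have s: "(sec x)\<^sup>2 = 1 + (tan x)\<^sup>2"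
      using tan_sec[OF x] by (simp add: sec_def power_divide inverse_eq_divide)
    show ?thesis unfolding s by (simp add: algebra_simps power2_eq_square)
  qed
  finally show "(deriv ^^ Suc n) (\<lambda>x. (sec x)\<^sup>2) x
      = poly (pderiv ?p * [:1, 0, 1:] + [:0, 2:] * ?p) (tan x) * (sec x)\<^sup>2"
    by simp
qed

text \<open>The total weight of the signed permutations over one Simsun word of length \<open>n\<close> with
  \<open>d\<close> descents.\<close>

definition term_poly :: "nat \<Rightarrow> nat \<Rightarrow> real poly" where
  "term_poly n d = smult (2 ^ (n - d)) (monom 1 (n - 2 * d) * [:1, 0, 1:] ^ d)"

text \<open>The map \<open>f \<mapsto> (1 + t\<^sup>2) f'\<close> multiplies \<open>(1 + t\<^sup>2)\<^sup>d\<close> by \<open>2 d t\<close>; together with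
  the summand \<open>2 t f\<close> this yields the coefficient \<open>d + 1\<close>, and differentiating \<open>t\<^bsup>n-2d\<^esup>\<close> yields the coefficient \<open>n - 2d\<close>. The two coefficients are the
  numbers of insertion gaps in \<open>sum_over_insertions\<close>.\<close>

lemma term_poly_recurrence:
  assumes "2 * d \<le> n"
  shows "pderiv (term_poly n d) * [:1, 0, 1:] + [:0, 2:] * term_poly n d
    = of_nat (d + 1) * term_poly (Suc n) d + of_nat (n - 2 * d) * term_poly (Suc n) (Suc d)"
proof -
  obtain m where n: "n = 2 * d + m" using assms le_iff_add by blast
  define Q :: "real poly" where "Q = [:1, 0, 1:]"
  have dQ: "pderiv (Q ^ d) * Q = of_nat (2 * d) * [:0, 1:] * Q ^ d"
  proof -
    have "pderiv (Q ^ d) * Q = smult (of_nat d) (Q ^ (d - 1) * Q * [:0, 2:])"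
      by (simp add: pderiv_power pderiv_pCons Q_def mult.commute mult.left_commute)
    also have "\<dots> = of_nat (2 * d) * [:0, 1:] * Q ^ d"
      by (cases d) (simp_all add: of_nat_poly algebra_simps)
    finally show ?thesis .
  qed
  have "poly (pderiv (term_poly n d) * Q + [:0, 2:] * term_poly n d) t
    = poly (of_nat (d + 1) * term_poly (Suc n) d + of_nat (n - 2 * d) * term_poly (Suc n) (Suc d)) t"
    for t
  proof -
    define q where "q = poly Q t"
    have q: "q = 1 + t * t" by (simp add: q_def Q_def)
    have d': "poly (pderiv (Q ^ d)) t * q = 2 * real d * t * q ^ d"
      using arg_cong[OF dQ, of "\<lambda>p. poly p t"] by (simp add: q_def)
    have "poly (pderiv (term_poly n d) * Q + [:0, 2:] * term_poly n d) t
        = 2 ^ (d + m) * (real m * t ^ (m - 1) * q ^ d * q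
            + t ^ m * (poly (pderiv (Q ^ d)) t * q) + 2 * t * t ^ m * q ^ d)"
      by (simp add: n term_poly_def pderiv_mult pderiv_smult pderiv_monom poly_monom
          flip: q_def Q_def) (simp add: algebra_simps)
    also have "\<dots> = (real d + 1) * (2 ^ (d + m + 1) * (t ^ (m + 1) * q ^ d))
        + real m * (2 ^ (d + m) * (t ^ (m - 1) * q ^ (d + 1)))"
      unfolding d' by (simp add: algebra_simps)
    also have "\<dots> = poly (of_nat (d + 1) * term_poly (Suc n) d
        + of_nat (n - 2 * d) * term_poly (Suc n) (Suc d)) t"
      by (cases m) (simp_all add: n term_poly_def poly_monom Suc_diff_le flip: q_def Q_def)
    finally show ?thesis .
  qed
  then show ?thesis by (simp add: Q_def poly_eq_poly_eq_iff[symmetric] fun_eq_iff)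
qed

section \<open>Descents under insertion of a maximal letter\<close>

text \<open>Positions are counted from \<open>0\<close>, and a descent is named by the position of its larger
  letter.\<close>

definition descents :: "int list \<Rightarrow> nat set" where
  "descents w = {i. Suc i < length w \<and> w ! i > w ! Suc i}"

lemma finite_descents [simp]: "finite (descents w)"
  by (rule finite_subset[of _ "{..<length w}"]) (auto simp: descents_def)

lemma has_double_descent_iff:
  "has_double_descent w \<longleftrightarrow> (\<exists>i. i \<in> descents w \<and> Suc i \<in> descents w)"
  by (simp add: has_double_descent_def descents_def) (meson Suc_lessD)

text \<open>Gap \<open>k\<close> lies just before the letter at position \<open>k\<close>; gap \<open>length w\<close> is the end
  of the word.\<close>

definition ins :: "nat \<Rightarrow> 'a \<Rightarrow> 'a list \<Rightarrow> 'a list" where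
  "ins k a w = take k w @ a # drop k w"

lemma length_ins: "length (ins k a w) = Suc (length w)"
  by (simp add: ins_def)

lemma nth_ins:
  assumes "k \<le> length w"
  shows "ins k a w ! i = (if i < k then w ! i else if i = k then a else w ! (i - 1))"
proof (cases "i > k")
  case True
  then obtain j where "i = Suc (k + j)" using less_imp_Suc_add by blast
  then show ?thesis using assms by (simp add: ins_def nth_append)
qed (use assms in \<open>auto simp: ins_def nth_append\<close>)

text \<open>A maximal letter is never the bottom of a descent, and it is a top unless it comes last. So the
  insertion destroys the descent straddling gap \<open>k\<close>, if there is one, adds a descent at \<open>k\<close>
  except at the end, and shifts the later ones by one.\<close>

lemma descents_ins:
  assumes "k \<le> length w" and "\<And>x. x \<in> set w \<Longrightarrow> x < a"
  shows "i \<in> descents (ins k a w) \<longleftrightarrow>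
    (if i < k then Suc i \<noteq> k \<and> i \<in> descents w
     else if i = k then k < length w else i - 1 \<in> descents w)"
proof -
  have lt: "j < length w \<Longrightarrow> w ! j < a" for j using assms(2) nth_mem by blast
  note simps = descents_def length_ins nth_ins[OF assms(1)]
  consider "Suc i < k" | "Suc i = k" | "i = k" | j where "i = Suc j" "k \<le> j"
    by (metis Suc_lessI Suc_le_D Suc_le_mono Suc_leI nat_neq_iff)
  then show ?thesis
  proof cases
    case 1
    then show ?thesis using assms(1) by (simp add: simps)
  next
    case 2
    then show ?thesis using assms(1) lt[of i] by (simp add: simps)
  next
    case 3
    then show ?thesis using lt[of k] by (auto simp: simps)
  next
    case (4 j)
    then show ?thesis by (simp add: simps)
  qed
qed

text \<open>The new letter can only be the first letter of a double descent. The descents to its left and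
  right were consecutive before the insertion if they are so afterwards.\<close>

lemma double_descent_ins_iff:
  assumes "k \<le> length w" and "\<And>x. x \<in> set w \<Longrightarrow> x < a" and "\<not> has_double_descent w"
  shows "has_double_descent (ins k a w) \<longleftrightarrow> k \<in> descents w"
proof
  assume "k \<in> descents w"
  then have "k \<in> descents (ins k a w)" "Suc k \<in> descents (ins k a w)"
    by (simp_all add: descents_ins[OF assms(1,2)]) (simp add: descents_def)
  then show "has_double_descent (ins k a w)" unfolding has_double_descent_iff by blast
next
  assume "has_double_descent (ins k a w)"
  then obtain i where i: "i \<in> descents (ins k a w)" "Suc i \<in> descents (ins k a w)"
    unfolding has_double_descent_iff by blast
  have ndd: "\<not> (j \<in> descents w \<and> Suc j \<in> descents w)" for j
    using assms(3) unfolding has_double_descent_iff by blast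
  consider "Suc i < k" | "Suc i = k" | "i = k" | j where "i = Suc j" "k \<le> j"
    by (metis Suc_lessI Suc_le_D Suc_le_mono Suc_leI nat_neq_iff)
  then show "k \<in> descents w"
    using i ndd[of i] ndd[of "i - 1"] by cases (simp_all add: descents_ins[OF assms(1,2)])
qed

text \<open>The descent created at gap \<open>k\<close> makes up for the one destroyed there when \<open>k\<close> is the
  position of a descent bottom.\<close>

lemma card_descents_ins:
  assumes "k \<le> length w" and "\<And>x. x \<in> set w \<Longrightarrow> x < a"
  shows "card (descents (ins k a w)) =
    (if k = length w \<or> k \<in> Suc ` descents w then card (descents w) else Suc (card (descents w)))"
proof -
  let ?D = "descents w"
  let ?f = "\<lambda>i. if i < k then i else Suc i"
  \<comment> \<open>the surviving descents are relocated injectively, avoiding position \<open>k\<close>\<close>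
  have eq: "descents (ins k a w) = ?f ` {i \<in> ?D. Suc i \<noteq> k} \<union> (if k < length w then {k} else {})"
    (is "_ = ?A \<union> ?B")
  proof (rule set_eqI)
    fix i
    have "i \<in> ?A \<longleftrightarrow> (if i < k then Suc i \<noteq> k \<and> i \<in> ?D else i \<noteq> k \<and> i - 1 \<in> ?D)"
    proof (cases "i > k")
      case True
      then have "i = ?f (i - 1)" by auto
      with True show ?thesis by (force split: if_splits)
    qed (force split: if_splits)
    then show "i \<in> descents (ins k a w) \<longleftrightarrow> i \<in> ?A \<union> ?B"
      by (auto simp: descents_ins[OF assms])
  qed
  have "card (descents (ins k a w)) = card ?A + card ?B"
    unfolding eq by (rule card_Un_disjoint) (auto split: if_splits)
  also have "card ?A = card {i \<in> ?D. Suc i \<noteq> k}"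
    by (rule card_image) (auto simp: inj_on_def split: if_splits)
  finally have card: "card (descents (ins k a w))
      = card {i \<in> ?D. Suc i \<noteq> k} + (if k < length w then 1 else 0)"
    by simp
  show ?thesis
  proof (cases "k \<in> Suc ` ?D")
    case True
    then obtain j where j: "k = Suc j" "j \<in> ?D" by blast
    then have "{i \<in> ?D. Suc i \<noteq> k} = ?D - {j}" by auto
    moreover have "k < length w" using j by (simp add: descents_def)
    moreover have "card ?D > 0" using j(2) card_gt_0_iff by fastforce
    ultimately show ?thesis using card True j(2) by simp
  next
    case False
    then have "{i \<in> ?D. Suc i \<noteq> k} = ?D" by auto
    with False card assms(1) show ?thesis by simp
  qed
qed

text \<open>Without double descents no letter is both a descent top and a descent bottom.\<close>

lemma two_card_descents_le:
  assumes "\<not> has_double_descent w"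
  shows "2 * card (descents w) \<le> length w"
proof -
  have "2 * card (descents w) = card (descents w \<union> Suc ` descents w)"
    using assms by (subst card_Un_disjoint) (auto simp: card_image has_double_descent_iff)
  also have "\<dots> \<le> card {..<length w}"
    by (rule card_mono) (auto simp: descents_def)
  finally show ?thesis by simp
qed

text \<open>The admissible gaps are those not before a descent top. They contain all gaps inside descents,
  because a descent bottom is never a top here, and the final gap: in total \<open>d + 1\<close> gaps that
  keep the number of descents, out of \<open>length w + 1 - d\<close>.\<close>

lemma sum_over_insertions:
  fixes F :: "nat \<Rightarrow> 'a :: comm_semiring_1"
  assumes "\<And>x. x \<in> set w \<Longrightarrow> x < a" and ndd: "\<not> has_double_descent w"
  defines "d \<equiv> card (descents w)"
  shows "(\<Sum>k\<in>{..length w} - descents w. F (card (descents (ins k a w))))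
    = of_nat (d + 1) * F d + of_nat (length w - 2 * d) * F (Suc d)"
proof -
  let ?D = "descents w" and ?n = "length w"
  let ?K = "insert ?n (Suc ` ?D)"
  have sub: "?K \<subseteq> {..?n} - ?D" "?D \<subseteq> {..?n}"
    using ndd by (auto simp: descents_def has_double_descent_iff)
  have "?n \<notin> Suc ` ?D" by (auto simp: descents_def)
  then have cK: "card ?K = d + 1" by (simp add: card_image d_def)
  have cR: "card ({..?n} - ?D - ?K) = ?n - 2 * d"
    using sub cK by (simp add: card_Diff_subset d_def finite_subset)
  have "(\<Sum>k\<in>{..?n} - ?D. F (card (descents (ins k a w))))
      = (\<Sum>k\<in>?K. F (card (descents (ins k a w))))
        + (\<Sum>k\<in>{..?n} - ?D - ?K. F (card (descents (ins k a w))))"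
    using sub by (subst add.commute, intro sum.subset_diff) auto
  also have "(\<Sum>k\<in>{..?n} - ?D - ?K. F (card (descents (ins k a w))))
      = (\<Sum>k\<in>{..?n} - ?D - ?K. F (Suc d))"
    by (rule sum.cong) (auto simp: card_descents_ins assms(1) d_def)
  also have "(\<Sum>k\<in>?K. F (card (descents (ins k a w)))) = (\<Sum>k\<in>?K. F d)"
    using sub by (intro sum.cong refl) (subst card_descents_ins, auto simp: assms(1) d_def)
  finally show ?thesis unfolding sum_constant cK cR .
qed

section \<open>Counting Simsun permutations by descents\<close>

lemma simsun_permutation: "w \<in> simsun n \<Longrightarrow> distinct w \<and> set w = {1..int n}"
  by (simp add: simsun_def permutations_of_set_def)

lemma length_simsun: "w \<in> simsun n \<Longrightarrow> length w = n"
  using simsun_permutation[of w n] distinct_card[of w] by simp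

lemma finite_simsun: "finite (simsun n)"
  by (rule finite_subset[of _ "permutations_of_set {1..int n}"]) (auto simp: simsun_def)

lemma simsun_no_double_descent:
  assumes "w \<in> simsun n"
  shows "\<not> has_double_descent w"
proof (cases "n = 0")
  case True
  then show ?thesis using length_simsun[OF assms] by (simp add: has_double_descent_def)
next
  case False
  have "filter (\<lambda>a. a \<le> int n) w = w"
    using simsun_permutation[OF assms] by (auto simp: filter_id_conv)
  moreover have "int n \<in> {1..int n}" using False by simp
  ultimately show ?thesis using assms unfolding simsun_def mem_Collect_eq by metis
qed

lemma simsun_0: "simsun 0 = {[]}"
  by (auto simp: simsun_def)

text \<open>The Simsun condition for the letters up to \<open>k \<le> n\<close> does not see the letter \<open>n + 1\<close>.\<close>

lemma simsun_Suc_iff: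
  "w \<in> simsun (Suc n) \<longleftrightarrow> w \<in> permutations_of_set {1..int (Suc n)} \<and> \<not> has_double_descent w
     \<and> filter (\<lambda>a. a \<le> int n) w \<in> simsun n"
proof (cases "w \<in> permutations_of_set {1..int (Suc n)}")
  case True
  then have w: "distinct w" "set w = {1..int (Suc n)}" by (auto simp: permutations_of_set_def)
  have full: "filter (\<lambda>a. a \<le> int (Suc n)) w = w" using w by (auto simp: filter_id_conv)
  have "filter (\<lambda>a. a \<le> int n) w \<in> permutations_of_set {1..int n}"
    using w by (auto simp: permutations_of_set_def)
  moreover have "filter (\<lambda>a. a \<le> k) (filter (\<lambda>a. a \<le> int n) w) = filter (\<lambda>a. a \<le> k) w"
    if "k \<le> int n" for k
    using that by (auto intro: filter_cong)
  moreover have "{1..int (Suc n)} = insert (int (Suc n)) {1..int n}" by auto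
  ultimately show ?thesis using True full by (auto simp: simsun_def)
qed (auto simp: simsun_def)

lemma filter_ins_simsun:
  assumes "w \<in> simsun n"
  shows "filter (\<lambda>a. a \<le> int n) (ins k (int (Suc n)) w) = w"
proof -
  have "filter (\<lambda>a. a \<le> int n) w = w"
    using simsun_permutation[OF assms] by (auto simp: filter_id_conv)
  moreover have "filter P (ins k a w) = filter P w" if "\<not> P a" for P and a :: int
  proof -
    have "filter P (ins k a w) = filter P (take k w @ drop k w)"
      unfolding ins_def filter_append using that by simp
    then show ?thesis by simp
  qed
  ultimately show ?thesis by simp
qed

lemma ins_mem_simsun_iff:
  assumes w: "w \<in> simsun n" and k: "k \<le> n"
  shows "ins k (int (Suc n)) w \<in> simsun (Suc n) \<longleftrightarrow> k \<notin> descents w"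
proof -
  have p: "distinct w" "set w = {1..int n}" using simsun_permutation[OF w] by auto
  have m: "mset (ins k (int (Suc n)) w) = mset (int (Suc n) # w)"
  proof -
    have "mset (take k w) + mset (drop k w) = mset w" by (simp flip: mset_append)
    then show ?thesis by (simp add: ins_def)
  qed
  have "ins k (int (Suc n)) w \<in> permutations_of_set {1..int (Suc n)}"
  proof -
    have "set (ins k (int (Suc n)) w) = {1..int (Suc n)}"
      using p mset_eq_setD[OF m] by auto
    moreover have "distinct (ins k (int (Suc n)) w)"
      using p mset_eq_imp_distinct_iff[OF m] by auto
    ultimately show ?thesis by (simp add: permutations_of_set_def)
  qed
  moreover have "has_double_descent (ins k (int (Suc n)) w) \<longleftrightarrow> k \<in> descents w"
    using p k length_simsun[OF w] simsun_no_double_descent[OF w]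
    by (intro double_descent_ins_iff) auto
  ultimately show ?thesis using w by (simp add: simsun_Suc_iff filter_ins_simsun[OF w] del: of_nat_Suc)
qed

text \<open>Deleting the letter \<open>n + 1\<close> and recording its position inverts the insertion; the position is
  the number of letters in front of it, read off by \<open>takeWhile\<close>.\<close>

lemma sum_simsun_Suc:
  fixes F :: "int list \<Rightarrow> 'a :: comm_monoid_add"
  shows "(\<Sum>w\<in>simsun (Suc n). F w)
    = (\<Sum>w\<in>simsun n. \<Sum>k\<in>{..n} - descents w. F (ins k (int (Suc n)) w))"
proof -
  let ?N = "int (Suc n)"
  let ?S = "SIGMA w:simsun n. {..n} - descents w"
  let ?pos = "\<lambda>w. length (takeWhile (\<lambda>a. a \<le> int n) w)"
  have tw: "?pos (ins k ?N w) = k" if "w \<in> simsun n" "k \<le> n" for k w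
  proof -
    have "takeWhile (\<lambda>a. a \<le> int n) (ins k ?N w) = take k w"
      unfolding ins_def using simsun_permutation[OF that(1)]
      by (subst takeWhile_append2) (auto dest: in_set_takeD)
    then show ?thesis using that length_simsun by simp
  qed
  have decomp: "filter (\<lambda>a. a \<le> int n) v \<in> simsun n \<and> ?pos v \<le> n
      \<and> ins (?pos v) ?N (filter (\<lambda>a. a \<le> int n) v) = v"
    if v: "v \<in> simsun (Suc n)" for v
  proof -
    have p: "distinct v" "set v = {1..?N}" using simsun_permutation[OF v] by auto
    then have "?N \<in> set v" by simp
    then obtain x y where xy: "v = x @ ?N # y" by (blast dest: split_list)
    have le: "\<forall>a\<in>set x \<union> set y. a \<le> int n"
    proof
      fix a assume "a \<in> set x \<union> set y"
      then have "a \<noteq> ?N" "a \<in> set v" using p(1) xy by auto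
      then show "a \<le> int n" using p(2) by auto
    qed
    have f: "filter (\<lambda>a. a \<le> int n) v = x @ y" using le xy by (simp add: filter_id_conv)
    have t: "takeWhile (\<lambda>a. a \<le> int n) v = x" using le xy by (simp add: takeWhile_append2)
    have "length x \<le> n" using length_simsun[OF v] xy by simp
    moreover have "x @ y \<in> simsun n" using v f by (simp add: simsun_Suc_iff)
    ultimately show ?thesis unfolding f t by (simp add: ins_def xy)
  qed
  have "(\<Sum>w\<in>simsun (Suc n). F w) = (\<Sum>(w, k)\<in>?S. F (ins k ?N w))"
  proof (rule sum.reindex_bij_witness[where
        i = "\<lambda>(w, k). ins k ?N w" and j = "\<lambda>v. (filter (\<lambda>a. a \<le> int n) v, ?pos v)"])
    fix v assume v: "v \<in> simsun (Suc n)"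
    show "(filter (\<lambda>a. a \<le> int n) v, ?pos v) \<in> ?S"
      using decomp[OF v] v ins_mem_simsun_iff[of "filter (\<lambda>a. a \<le> int n) v" n "?pos v"] by auto
  next
    fix p assume "p \<in> ?S"
    then obtain w k where p: "p = (w, k)" "w \<in> simsun n" "k \<le> n" "k \<notin> descents w" by blast
    show "(\<lambda>v. (filter (\<lambda>a. a \<le> int n) v, ?pos v)) ((\<lambda>(w, k). ins k ?N w) p) = p"
      using p tw[OF p(2,3)] filter_ins_simsun[OF p(2), of k] by simp
    show "(\<lambda>(w, k). ins k ?N w) p \<in> simsun (Suc n)"
      using p ins_mem_simsun_iff[OF p(2,3)] by simp
  qed (simp_all add: decomp del: of_nat_Suc)
  also have "\<dots> = (\<Sum>w\<in>simsun n. \<Sum>k\<in>{..n} - descents w. F (ins k ?N w))"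
    by (subst sum.Sigma) (auto simp: finite_simsun)
  finally show ?thesis .
qed

lemma R_poly_eq_sum_simsun: "R_poly n = (\<Sum>w\<in>simsun n. term_poly n (card (descents w)))"
proof (induction n)
  case 0
  have "descents [] = {}" by (simp add: descents_def)
  then show ?case by (simp add: R_poly_0 simsun_0 term_poly_def)
next
  case (Suc n)
  have "R_poly (Suc n) = (\<Sum>w\<in>simsun n. pderiv (term_poly n (card (descents w))) * [:1, 0, 1:]
      + [:0, 2:] * term_poly n (card (descents w)))"
    unfolding R_poly_Suc Suc.IH
    by (simp only: higher_pderiv_sum[of 1, simplified] sum_distrib_left sum_distrib_right sum.distrib)
  also have "\<dots> = (\<Sum>w\<in>simsun n. \<Sum>k\<in>{..n} - descents w.
      term_poly (Suc n) (card (descents (ins k (int (Suc n)) w))))"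
  proof (rule sum.cong[OF refl])
    fix w assume w: "w \<in> simsun n"
    note len = length_simsun[OF w] and ndd = simsun_no_double_descent[OF w]
    have lt: "x < int (Suc n)" if "x \<in> set w" for x using that simsun_permutation[OF w] by simp
    show "pderiv (term_poly n (card (descents w))) * [:1, 0, 1:]
        + [:0, 2:] * term_poly n (card (descents w))
      = (\<Sum>k\<in>{..n} - descents w. term_poly (Suc n) (card (descents (ins k (int (Suc n)) w))))"
      using sum_over_insertions[OF lt ndd, of "term_poly (Suc n)"]
        two_card_descents_le[OF ndd] term_poly_recurrence len by simp
  qed
  also have "\<dots> = (\<Sum>w\<in>simsun (Suc n). term_poly (Suc n) (card (descents w)))"
    by (rule sum_simsun_Suc[symmetric])
  finally show ?case .
qed

section \<open>Distributing the signs\<close>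

text \<open>Positions are counted from \<open>0\<close>, to match \<open>descents\<close>; position \<open>j\<close> of the word is
  the argument \<open>j + 1\<close> of \<open>\<sigma>\<close>.\<close>

definition neg_positions :: "nat \<Rightarrow> (int \<Rightarrow> int) \<Rightarrow> nat set" where
  "neg_positions n \<sigma> = {j. j < n \<and> \<sigma> (int j + 1) < 0}"

text \<open>The odd extension of the word \<open>w\<close> with minus signs at the positions in \<open>N\<close>, and the
  identity outside the signed domain.\<close>

definition signed_perm_of :: "nat \<Rightarrow> int list \<Rightarrow> nat set \<Rightarrow> int \<Rightarrow> int" where
  "signed_perm_of n w N i = (if i \<in> signed_dom n
     then sgn i * (if nat \<bar>i\<bar> - 1 \<in> N then -1 else 1) * w ! (nat \<bar>i\<bar> - 1) else i)"

lemma length_abs_word: "length (abs_word n \<sigma>) = n"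
  by (simp add: abs_word_def)

lemma nth_abs_word: "j < n \<Longrightarrow> abs_word n \<sigma> ! j = \<bar>\<sigma> (int j + 1)\<bar>"
  by (simp add: abs_word_def add.commute)

lemma npk_eq: "npk n \<sigma> = card (neg_positions n \<sigma> \<inter> descents (abs_word n \<sigma>))"
proof -
  have "{i. 1 \<le> i \<and> i \<le> int n - 1 \<and> \<sigma> i < 0 \<and> \<bar>\<sigma> i\<bar> > \<bar>\<sigma> (i + 1)\<bar>}
    = (\<lambda>j. int j + 1) ` (neg_positions n \<sigma> \<inter> descents (abs_word n \<sigma>))" (is "?A = ?f ` ?B")
  proof (intro equalityI subsetI)
    fix i assume i: "i \<in> ?A"
    then have e: "i = ?f (nat (i - 1))" by simp
    have "nat (i - 1) \<in> ?B"
      using i by (auto simp: neg_positions_def descents_def length_abs_word nth_abs_word add.commute)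
    with e show "i \<in> ?f ` ?B" by blast
  qed (auto simp: neg_positions_def descents_def length_abs_word nth_abs_word algebra_simps)
  then show ?thesis unfolding npk_def by (simp add: card_image inj_on_def)
qed

lemma signed_dom_cases:
  assumes "i \<in> signed_dom n"
  obtains (pos) j where "j < n" "i = int j + 1" | (neg) j where "j < n" "i = - (int j + 1)"
proof (cases "i > 0")
  case True
  then show ?thesis using assms pos[of "nat (i - 1)"] by (auto simp: signed_dom_def)
next
  case False
  then show ?thesis using assms neg[of "nat (- i - 1)"] by (auto simp: signed_dom_def)
qed

lemma signed_perm_of_eval:
  assumes "j < n"
  shows "signed_perm_of n w N (int j + 1) = (if j \<in> N then - (w ! j) else w ! j)"
    and "signed_perm_of n w N (- (int j + 1)) = (if j \<in> N then w ! j else - (w ! j))"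
proof -
  have "int j + 1 \<in> signed_dom n" "- (int j + 1) \<in> signed_dom n" "nat \<bar>int j + 1\<bar> - 1 = j"
    "nat \<bar>- (int j + 1)\<bar> - 1 = j" "sgn (int j + 1) = 1" "sgn (- (int j + 1)) = -1"
    using assms by (auto simp: signed_dom_def)
  then show "signed_perm_of n w N (int j + 1) = (if j \<in> N then - (w ! j) else w ! j)"
    "signed_perm_of n w N (- (int j + 1)) = (if j \<in> N then w ! j else - (w ! j))"
    unfolding signed_perm_of_def by simp_all
qed

lemma signed_perm_of_in_signed_perms:
  assumes "distinct w" "set w = {1..int n}"
  shows "signed_perm_of n w N \<in> signed_perms n"
proof -
  let ?\<sigma> = "signed_perm_of n w N"
  have len: "length w = n" using assms distinct_card[of w] by simp
  have range: "w ! j \<in> {1..int n}" if "j < n" for j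
    using that len nth_mem[of j w] assms(2) by simp
  \<comment> \<open>the letters of \<open>w\<close> are positive and distinct, so a value determines its position up to
    sign, and then the sign\<close>
  have inj: "inj_on ?\<sigma> (signed_dom n)"
  proof (rule inj_onI)
    fix x y assume x: "x \<in> signed_dom n" and y: "y \<in> signed_dom n" and eq: "?\<sigma> x = ?\<sigma> y"
    from x show "x = y"
    proof (cases rule: signed_dom_cases)
      case (pos j)
      note p = pos
      from y show ?thesis
      proof (cases rule: signed_dom_cases)
        case (pos l)
        then show ?thesis using p eq range[of j] range[of l] nth_eq_iff_index_eq[OF assms(1)] len
          by (auto simp: signed_perm_of_eval split: if_splits)
      next
        case (neg l)
        then show ?thesis using p eq range[of j] range[of l] nth_eq_iff_index_eq[OF assms(1)] len
          by (auto simp: signed_perm_of_eval simp del: minus_add_distrib split: if_splits)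
      qed
    next
      case (neg j)
      note p = neg
      from y show ?thesis
      proof (cases rule: signed_dom_cases)
        case (pos l)
        then show ?thesis using p eq range[of j] range[of l] nth_eq_iff_index_eq[OF assms(1)] len
          by (auto simp: signed_perm_of_eval simp del: minus_add_distrib split: if_splits)
      next
        case (neg l)
        then show ?thesis using p eq range[of j] range[of l] nth_eq_iff_index_eq[OF assms(1)] len
          by (auto simp: signed_perm_of_eval simp del: minus_add_distrib split: if_splits)
      qed
    qed
  qed
  have "?\<sigma> i \<in> signed_dom n \<and> ?\<sigma> (- i) = - ?\<sigma> i" if "i \<in> signed_dom n" for i
    using that
  proof (cases rule: signed_dom_cases)
    case (pos j)
    then show ?thesis using range[of j]
      by (auto simp: signed_perm_of_eval signed_dom_def simp del: minus_add_distrib)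
  next
    case (neg j)
    then show ?thesis using range[of j]
      by (auto simp: signed_perm_of_eval signed_dom_def simp del: minus_add_distrib
          simp flip: minus_add_distrib)
  qed
  note closed = this
  have fin: "finite (signed_dom n)" by (simp add: signed_dom_def)
  have "?\<sigma> permutes signed_dom n"
  proof (rule bij_imp_permutes)
    show "bij_betw ?\<sigma> (signed_dom n) (signed_dom n)"
      using endo_inj_surj[OF fin _ inj] closed inj by (auto simp: bij_betw_def)
  qed (simp add: signed_perm_of_def)
  then show ?thesis using closed by (simp add: signed_perms_def)
qed

lemma abs_word_signed_perm_of:
  assumes "w \<in> simsun n"
  shows "abs_word n (signed_perm_of n w N) = w"
proof (rule nth_equalityI)
  fix j assume "j < length (abs_word n (signed_perm_of n w N))"
  then have j: "j < n" by (simp add: length_abs_word)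
  then have "w ! j \<ge> 1" using simsun_permutation[OF assms] length_simsun[OF assms] nth_mem[of j w] by simp
  then show "abs_word n (signed_perm_of n w N) ! j = w ! j"
    using j by (simp add: nth_abs_word signed_perm_of_eval)
qed (simp add: length_abs_word length_simsun[OF assms])

lemma neg_positions_signed_perm_of:
  assumes "w \<in> simsun n" and "N \<subseteq> {..<n}"
  shows "neg_positions n (signed_perm_of n w N) = N"
proof -
  have "w ! j \<ge> 1" if "j < n" for j
    using that simsun_permutation[OF assms(1)] length_simsun[OF assms(1)] nth_mem[of j w] by simp
  then show ?thesis using assms(2)
    by (force simp: neg_positions_def signed_perm_of_eval split: if_splits)
qed

lemma signed_perm_of_abs_word:
  assumes "\<sigma> \<in> signed_perms n"
  shows "signed_perm_of n (abs_word n \<sigma>) (neg_positions n \<sigma>) = \<sigma>"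
proof
  fix i
  have perm: "\<sigma> permutes signed_dom n" and odd: "\<And>i. i \<in> signed_dom n \<Longrightarrow> \<sigma> (- i) = - \<sigma> i"
    using assms by (auto simp: signed_perms_def)
  show "signed_perm_of n (abs_word n \<sigma>) (neg_positions n \<sigma>) i = \<sigma> i"
  proof (cases "i \<in> signed_dom n")
    case True
    then show ?thesis
    proof (cases rule: signed_dom_cases)
      case (pos j)
      then show ?thesis by (simp add: signed_perm_of_eval nth_abs_word neg_positions_def)
    next
      case (neg j)
      then have "int j + 1 \<in> signed_dom n" by (auto simp: signed_dom_def)
      then have "\<sigma> i = - \<sigma> (int j + 1)" using odd neg by blast
      then show ?thesis unfolding neg(2) signed_perm_of_eval(2)[OF neg(1)]
        using neg(1) by (simp add: nth_abs_word neg_positions_def)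
    qed
  next
    case False
    then show ?thesis using permutes_not_in[OF perm] by (simp add: signed_perm_of_def)
  qed
qed

text \<open>A signed permutation amounts to its word of absolute values together with an arbitrary set of
  negative positions, so summing over \<open>RSI n\<close> is a double sum.\<close>

lemma sum_RSI:
  fixes F :: "int list \<Rightarrow> nat set \<Rightarrow> 'a :: comm_monoid_add"
  shows "(\<Sum>\<sigma>\<in>RSI n. F (abs_word n \<sigma>) (neg_positions n \<sigma>))
    = (\<Sum>w\<in>simsun n. \<Sum>N\<in>Pow {..<n}. F w N)"
proof -
  have "(\<Sum>\<sigma>\<in>RSI n. F (abs_word n \<sigma>) (neg_positions n \<sigma>))
      = (\<Sum>(w, N)\<in>simsun n \<times> Pow {..<n}. F w N)"
  proof (rule sum.reindex_bij_witness[where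
        i = "\<lambda>(w, N). signed_perm_of n w N" and j = "\<lambda>\<sigma>. (abs_word n \<sigma>, neg_positions n \<sigma>)"])
    fix p assume p: "p \<in> simsun n \<times> Pow {..<n}"
    then show "(case p of (w, N) \<Rightarrow> signed_perm_of n w N) \<in> RSI n"
      using simsun_permutation signed_perm_of_in_signed_perms
      by (auto simp: RSI_def abs_word_signed_perm_of)
    show "(\<lambda>\<sigma>. (abs_word n \<sigma>, neg_positions n \<sigma>)) (case p of (w, N) \<Rightarrow> signed_perm_of n w N) = p"
      using p by (auto simp: abs_word_signed_perm_of neg_positions_signed_perm_of)
  next
    fix \<sigma> assume "\<sigma> \<in> RSI n"
    then show "(abs_word n \<sigma>, neg_positions n \<sigma>) \<in> simsun n \<times> Pow {..<n}"
      by (auto simp: RSI_def neg_positions_def)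
  qed (simp_all add: RSI_def signed_perm_of_abs_word)
  then show ?thesis by (simp add: sum.cartesian_product)
qed

text \<open>Multiplying out \<open>\<Prod>i<n. 1 + g i\<close> with \<open>g i = t\<^sup>2\<close> on \<open>D\<close> and \<open>g i = 1\<close> elsewhere
  produces one summand for each set \<open>N\<close>: choosing the term \<open>1\<close> at \<open>i\<close> means
  \<open>i \<in> N\<close>. Relative to the lowest possible degree \<open>n - 2 card D\<close>, a descent with positive top
  gains \<open>t\<^sup>2\<close>.\<close>

lemma sum_signs:
  assumes D: "D \<subseteq> {..<n}" and le: "2 * card D \<le> n"
  shows "(\<Sum>N\<in>Pow {..<n}. monom (1 :: real) (n - 2 * card (N \<inter> D))) = term_poly n (card D)"
proof -
  have fin: "finite D" using D finite_subset by blast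
  let ?g = "\<lambda>i. if i \<in> D then monom (1 :: real) 2 else 1"
  have "(\<Sum>N\<in>Pow {..<n}. monom (1 :: real) (n - 2 * card (N \<inter> D)))
      = (\<Sum>N\<in>Pow {..<n}. monom 1 (n - 2 * card D) * (prod (\<lambda>_. 1) N * prod ?g ({..<n} - N)))"
  proof (rule sum.cong[OF refl])
    fix N assume "N \<in> Pow {..<n}"
    have "prod ?g ({..<n} - N) = prod (\<lambda>_. monom 1 2) (({..<n} - N) \<inter> D)"
      by (rule prod.inter_restrict[symmetric]) simp
    also have "({..<n} - N) \<inter> D = D - N \<inter> D" using D by auto
    also have "prod (\<lambda>_. monom (1 :: real) 2) (D - N \<inter> D) = monom 1 (2 * (card D - card (N \<inter> D)))"
      using fin by (simp add: monom_power card_Diff_subset)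
    finally have "prod ?g ({..<n} - N) = monom 1 (2 * (card D - card (N \<inter> D)))" .
    moreover have "card (N \<inter> D) \<le> card D" using fin by (simp add: card_mono)
    then have "n - 2 * card (N \<inter> D) = n - 2 * card D + 2 * (card D - card (N \<inter> D))" using le by simp
    ultimately show "monom (1 :: real) (n - 2 * card (N \<inter> D))
        = monom 1 (n - 2 * card D) * (prod (\<lambda>_. 1) N * prod ?g ({..<n} - N))"
      by (simp add: mult_monom)
  qed
  also have "\<dots> = monom 1 (n - 2 * card D) * (\<Prod>i<n. 1 + ?g i)"
    by (simp add: prod_add sum_distrib_left)
  also have "(\<Prod>i<n. 1 + ?g i) = (\<Prod>i\<in>{..<n} - D. 2) * (\<Prod>i\<in>D. 1 + monom 1 2)"
    using D by (subst prod.subset_diff[of D]) (auto intro!: arg_cong2[where f = "(*)"] prod.cong)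
  also have "\<dots> = smult (2 ^ (n - card D)) ([:1, 0, 1:] ^ card D)"
  proof -
    have "1 + monom (1 :: real) 2 = [:1, 0, 1:]"
      by (simp add: monom_altdef power2_eq_square one_pCons)
    moreover have "(2 :: real poly) ^ k = [:2 ^ k:]" for k
      by (induction k) (auto simp: one_pCons numeral_poly)
    ultimately show ?thesis using D fin by (simp add: card_Diff_subset)
  qed
  finally show ?thesis by (simp add: term_poly_def)
qed

theorem theorem2p5:
  fixes n :: nat
  assumes "n \<ge> 1"
  shows "R_poly n = (\<Sum>\<sigma>\<in>RSI n. monom 1 (n - 2 * npk n \<sigma>))"
proof -
  have "(\<Sum>\<sigma>\<in>RSI n. monom (1 :: real) (n - 2 * npk n \<sigma>))
      = (\<Sum>w\<in>simsun n. \<Sum>N\<in>Pow {..<n}. monom 1 (n - 2 * card (N \<inter> descents w)))"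
    unfolding npk_eq by (rule sum_RSI)
  also have "\<dots> = (\<Sum>w\<in>simsun n. term_poly n (card (descents w)))"
  proof (intro sum.cong refl sum_signs)
    fix w assume w: "w \<in> simsun n"
    show "descents w \<subseteq> {..<n}" using length_simsun[OF w] by (auto simp: descents_def)
    show "2 * card (descents w) \<le> n"
      using two_card_descents_le[OF simsun_no_double_descent[OF w]] length_simsun[OF w] by simp
  qed
  finally show ?thesis by (simp add: R_poly_eq_sum_simsun)
qed

end
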